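(* Let $A$ be an asymmetric fuzzy number and let $a_m = 0.5(\underline{a}_1+\overline{a}_1)$, where $[A]_1=[\underline{a}_1,\overline{a}_1]$. Define a relation $\leq$ on $\mathbb{R}_{\mathcal{F}(A)}$ as follows: for $B=r_B+q_BA$ and $C=r_C+q_CA$ in $\mathbb{R}_{\mathcal{F}(A)}$, $B\leq C$ if and only if one of the following holds: (I) $r_B+q_Ba_m<r_C+q_Ca_m$; or (II) $r_B+q_Ba_m=r_C+q_Ca_m$ and $|q_B|<|q_C|$; or (III) $r_B+q_Ba_m=r_C+q_Ca_m$ and $|q_B|=|q_C|$ and $q_B\leq q_C$. Then $\leq$ is an order relation on $\mathbb{R}_{\mathcal{F}(A)}$ (reflexive, antisymmetric and transitive) and $\mathbb{R}_{\mathcal{F}(A)}$ is totally ordered by it, i.e. for all $B,C\in\mathbb{R}_{\mathcal{F}(A)}$ we have $B\leq C$ or $C\leq B$.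
   Context: A fuzzy subset of $\mathbb{R}$ is a function $A:\mathbb{R}\to[0,1]$; its $\alpha$-levels are $[A]_\alpha=\{x: A(x)\geq\alpha\}$ for $0<\alpha\leq1$ and $[A]_0=\overline{\{x:A(x)>0\}}$. $A$ is a fuzzy number if all its $\alpha$-levels are nonempty closed intervals, written $[A]_\alpha=[\underline a_\alpha,\overline a_\alpha]$, and $\{x:A(x)>0\}$ is bounded. For $r,q\in\mathbb{R}$, $r+qA$ is the fuzzy number with $[r+qA]_\alpha=\{r+qx: x\in[A]_\alpha\}$ for every $\alpha\in[0,1]$; in particular $r+0A$ is identified with the real number $r$. $A$ is asymmetric if for every $x\in\mathbb{R}$ there exists $y\in\mathbb{R}$ with $A(x-y)\neq A(x+y)$. Put $\mathbb{R}_{\mathcal{F}(A)}=\{r+qA: r,q\in\mathbb{R}\}$. When $A$ is asymmetric, the map $(r,q)\mapsto r+qA$ is a bijection from $\mathbb{R}^2$ onto $\mathbb{R}_{\mathcal{F}(A)}$, so $r,q$ are uniquely determined by $r+qA$. *)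

theory Defs
  imports "HOL-Analysis.Analysis"
begin

definition fuzzy_subset :: "(real \<Rightarrow> real) \<Rightarrow> bool" where
  "fuzzy_subset A \<longleftrightarrow> (\<forall>x. 0 \<le> A x \<and> A x \<le> 1)"

text \<open>Only levels \<open>0 \<le> \<alpha> \<le> 1\<close> are meaningful.\<close>

definition level :: "(real \<Rightarrow> real) \<Rightarrow> real \<Rightarrow> real set" where
  "level A \<alpha> = (if \<alpha> = 0 then closure {x. A x > 0} else {x. A x \<ge> \<alpha>})"

definition fuzzy_number :: "(real \<Rightarrow> real) \<Rightarrow> bool" where
  "fuzzy_number A \<longleftrightarrow> fuzzy_subset A
     \<and> (\<forall>\<alpha>\<in>{0..1}. \<exists>l u. l \<le> u \<and> level A \<alpha> = {l..u})
     \<and> bounded {x. A x > 0}"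

definition lower :: "(real \<Rightarrow> real) \<Rightarrow> real \<Rightarrow> real" where
  "lower A \<alpha> = Inf (level A \<alpha>)"

definition upper :: "(real \<Rightarrow> real) \<Rightarrow> real \<Rightarrow> real" where
  "upper A \<alpha> = Sup (level A \<alpha>)"

definition midpoint1 :: "(real \<Rightarrow> real) \<Rightarrow> real" where
  "midpoint1 A = (lower A 1 + upper A 1) / 2"

definition asymmetric :: "(real \<Rightarrow> real) \<Rightarrow> bool" where
  "asymmetric A \<longleftrightarrow> (\<forall>x. \<exists>y. A (x - y) \<noteq> A (x + y))"

text \<open>The fuzzy number \<open>r + q A\<close> is specified through its levels; existence and
  uniqueness for a fuzzy number \<open>A\<close> are shown in \<open>ex1_affine\<close> below.\<close>

definition affine_fuzzy :: "(real \<Rightarrow> real) \<Rightarrow> real \<Rightarrow> real \<Rightarrow> (real \<Rightarrow> real)" where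
  "affine_fuzzy A r q =
     (THE B. fuzzy_number B \<and> (\<forall>\<alpha>\<in>{0..1}. level B \<alpha> = {r + q * x |x. x \<in> level A \<alpha>}))"

definition fuzzy_span :: "(real \<Rightarrow> real) \<Rightarrow> (real \<Rightarrow> real) set" where
  "fuzzy_span A = {affine_fuzzy A r q |r q. True}"

text \<open>For asymmetric \<open>A\<close> the coefficients are uniquely determined by the fuzzy number
  (see \<open>affine_fuzzy_inject\<close> below), so the existential quantifier merely names them.\<close>

definition fuzzy_order :: "(real \<Rightarrow> real) \<Rightarrow> ((real \<Rightarrow> real) \<times> (real \<Rightarrow> real)) set" where
  "fuzzy_order A = {(B, C). \<exists>r\<^sub>B q\<^sub>B r\<^sub>C q\<^sub>C.
     B = affine_fuzzy A r\<^sub>B q\<^sub>B \<and> C = affine_fuzzy A r\<^sub>C q\<^sub>C \<and>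
     (let m = midpoint1 A in
        r\<^sub>B + q\<^sub>B * m < r\<^sub>C + q\<^sub>C * m
      \<or> (r\<^sub>B + q\<^sub>B * m = r\<^sub>C + q\<^sub>C * m \<and> \<bar>q\<^sub>B\<bar> < \<bar>q\<^sub>C\<bar>)
      \<or> (r\<^sub>B + q\<^sub>B * m = r\<^sub>C + q\<^sub>C * m \<and> \<bar>q\<^sub>B\<bar> = \<bar>q\<^sub>C\<bar> \<and> q\<^sub>B \<le> q\<^sub>C))}"

lemma fuzzy_number_eqI:
  assumes "fuzzy_subset B" "fuzzy_subset C"
    and "\<And>\<alpha>. 0 < \<alpha> \<Longrightarrow> \<alpha> \<le> 1 \<Longrightarrow> level B \<alpha> = level C \<alpha>"
  shows "B = C"
proof
  fix x
  have le: "D x \<le> E x"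
    if "fuzzy_subset D" "fuzzy_subset E"
      "\<And>\<alpha>. 0 < \<alpha> \<Longrightarrow> \<alpha> \<le> 1 \<Longrightarrow> level D \<alpha> = level E \<alpha>" for D E
  proof (cases "D x = 0")
    case True
    then show ?thesis using that(2) by (simp add: fuzzy_subset_def)
  next
    case False
    then have "0 < D x" "D x \<le> 1"
      using that(1) by (simp_all add: fuzzy_subset_def order_less_le)
    then have "x \<in> level E (D x)"
      using that(3)[of "D x"] False by (auto simp: level_def)
    then show ?thesis using False by (simp add: level_def)
  qed
  show "B x = C x"
    using le[of B C] le[of C B] assms by (simp add: order_antisym)
qed

lemma image_affine_interval:
  fixes r q l u :: real
  assumes "l \<le> u"
  shows "\<exists>l' u'. l' \<le> u' \<and> {r + q * x |x. x \<in> {l..u}} = {l'..u'}"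
proof -
  have "{r + q * x |x. x \<in> {l..u}} = (\<lambda>x. q * x + r) ` {l..u}"
    by (auto simp: add.commute)
  also have "\<dots> = (if 0 \<le> q then {q * l + r..q * u + r} else {q * u + r..q * l + r})"
    using assms by (simp add: image_affinity_atLeastAtMost)
  finally have eq: "{r + q * x |x. x \<in> {l..u}} = \<dots>" .
  show ?thesis
  proof (cases "0 \<le> q")
    case True
    then have "q * l + r \<le> q * u + r" using assms by (simp add: mult_left_mono)
    then show ?thesis using eq True by fastforce
  next
    case False
    then have "q * u + r \<le> q * l + r" using assms by (simp add: mult_left_mono_neg)
    then show ?thesis using eq False by fastforce
  qed
qed

lemma fuzzy_number_subset: "fuzzy_number A \<Longrightarrow> fuzzy_subset A"
  unfolding fuzzy_number_def by (rule conjunct1)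

lemma fuzzy_number_level:
  assumes "fuzzy_number A" "\<alpha> \<in> {0..1}"
  obtains l u where "l \<le> u" "level A \<alpha> = {l..u}"
  using bspec[OF conjunct1[OF conjunct2[OF assms(1)[unfolded fuzzy_number_def]]] assms(2)]
  by (elim exE conjE)

lemma ex1_affine:
  assumes A: "fuzzy_number A"
  shows "\<exists>!B. fuzzy_number B \<and> (\<forall>\<alpha>\<in>{0..1}. level B \<alpha> = {r + q * x |x. x \<in> level A \<alpha>})"
proof -
  have ne: "level A \<alpha> \<noteq> {}" if \<alpha>: "\<alpha> \<in> {0..1}" for \<alpha>
  proof -
    obtain l u where "l \<le> u" "level A \<alpha> = {l..u}"
      using fuzzy_number_level[OF A \<alpha>] .
    then show ?thesis by simp
  qed
  define B where "B = (if q = 0 then (\<lambda>y. if y = r then 1 else 0) else (\<lambda>y. A ((y - r) / q)))"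
  have sub: "fuzzy_subset B"
    using fuzzy_number_subset[OF A] by (simp add: B_def fuzzy_subset_def)
  have img: "{y. P ((y - r) / q)} = (\<lambda>x. r + q * x) ` {x. P x}" if "q \<noteq> 0" for P
  proof (intro set_eqI iffI)
    fix y assume "y \<in> {y. P ((y - r) / q)}"
    then show "y \<in> (\<lambda>x. r + q * x) ` {x. P x}"
      using that by (intro image_eqI[where x = "(y - r) / q"]) auto
  qed (use that in auto)
  have hom: "closure ((\<lambda>x. r + q * x) ` S) = (\<lambda>x. r + q * x) ` closure S" for S
  proof -
    have "(\<lambda>x. r + q * x) ` S = (+) r ` ((\<lambda>x. q *\<^sub>R x) ` S)" for S
      by (simp add: image_image)
    then show ?thesis by (simp only: closure_translation closure_scaleR)
  qed
  have lev: "level B \<alpha> = {r + q * x |x. x \<in> level A \<alpha>}" if "\<alpha> \<in> {0..1}" for \<alpha>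
  proof (cases "q = 0")
    case True
    have "{x. (if x = r then 1 else 0::real) > 0} = {r}"
      and "\<alpha> \<noteq> 0 \<Longrightarrow> {x. (if x = r then 1 else 0::real) \<ge> \<alpha>} = {r}"
      using that by (auto split: if_splits)
    then have "level B \<alpha> = {r}" using True by (simp add: level_def B_def)
    then show ?thesis using True ne[OF that] by auto
  next
    case False
    have "level B \<alpha> = (\<lambda>x. r + q * x) ` level A \<alpha>"
      using False hom img[of "\<lambda>x. A x > 0"] img[of "\<lambda>x. A x \<ge> \<alpha>"]
      by (simp add: level_def B_def)
    then show ?thesis by auto
  qed
  have int: "\<exists>l u. l \<le> u \<and> level B \<alpha> = {l..u}" if \<alpha>: "\<alpha> \<in> {0..1}" for \<alpha>
  proof -
    obtain l u where "l \<le> u" "level A \<alpha> = {l..u}"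
      using fuzzy_number_level[OF A \<alpha>] .
    then show ?thesis using image_affine_interval[of l u r q] lev[OF \<alpha>] by simp
  qed
  obtain l u where "level B 0 = {l..u}" using int[of 0] by auto
  then have "{x. B x > 0} \<subseteq> {l..u}"
    using closure_subset[of "{x. B x > 0}"] by (simp add: level_def)
  then have "bounded {x. B x > 0}" using bounded_closed_interval bounded_subset by blast
  then have B: "fuzzy_number B" using sub int by (simp add: fuzzy_number_def)
  show ?thesis
  proof (rule ex1I[of _ B])
    show "C = B" if "fuzzy_number C \<and> (\<forall>\<alpha>\<in>{0..1}. level C \<alpha> = {r + q * x |x. x \<in> level A \<alpha>})" for C
      using that sub lev fuzzy_number_subset[of C] by (intro fuzzy_number_eqI) simp_all
  qed (use B lev in auto)
qed

lemma level_affine_fuzzy: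
  assumes "fuzzy_number A" "\<alpha> \<in> {0..1}"
  shows "level (affine_fuzzy A r q) \<alpha> = {r + q * x |x. x \<in> level A \<alpha>}"
  using theI'[OF ex1_affine[OF assms(1), of r q]] assms(2) unfolding affine_fuzzy_def by blast

lemma lower_upper_interval:
  assumes "l \<le> u" "level B \<alpha> = {l..u}"
  shows "lower B \<alpha> = l" "upper B \<alpha> = u"
  using assms by (auto simp: lower_def upper_def)

lemma sum_lower_upper_affine_fuzzy:
  assumes "fuzzy_number A" "\<alpha> \<in> {0..1}"
  shows "upper (affine_fuzzy A r q) \<alpha> + lower (affine_fuzzy A r q) \<alpha>
           = 2 * r + q * (upper A \<alpha> + lower A \<alpha>)"
proof -
  obtain l u where lu: "l \<le> u" "level A \<alpha> = {l..u}"
    using fuzzy_number_level[OF assms] .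
  have "level (affine_fuzzy A r q) \<alpha> = (\<lambda>x. q * x + r) ` {l..u}"
    using level_affine_fuzzy[OF assms] lu by (auto simp: add.commute)
  also have "\<dots> = (if 0 \<le> q then {q * l + r..q * u + r} else {q * u + r..q * l + r})"
    using lu by (simp add: image_affinity_atLeastAtMost)
  finally have *: "level (affine_fuzzy A r q) \<alpha> = \<dots>" .
  have "upper (affine_fuzzy A r q) \<alpha> = (if 0 \<le> q then q * u + r else q * l + r)
      \<and> lower (affine_fuzzy A r q) \<alpha> = (if 0 \<le> q then q * l + r else q * u + r)"
  proof (cases "0 \<le> q")
    case True
    then have le: "q * l + r \<le> q * u + r" using lu by (simp add: mult_left_mono)
    then show ?thesis using lower_upper_interval[OF le, of "affine_fuzzy A r q" \<alpha>] * True by simp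
  next
    case False
    then have le: "q * u + r \<le> q * l + r" using lu by (simp add: mult_left_mono_neg)
    then show ?thesis using lower_upper_interval[OF le, of "affine_fuzzy A r q" \<alpha>] * False by simp
  qed
  then show "upper (affine_fuzzy A r q) \<alpha> + lower (affine_fuzzy A r q) \<alpha>
           = 2 * r + q * (upper A \<alpha> + lower A \<alpha>)"
    using lower_upper_interval[OF lu] by (auto simp: algebra_simps)
qed

lemma symmetric_if_constant_midpoints:
  assumes A: "fuzzy_number A"
    and c: "\<And>\<alpha>. \<alpha> \<in> {0..1} \<Longrightarrow> upper A \<alpha> + lower A \<alpha> = 2 * c"
  shows "A (c - y) = A (c + y)"
proof -
  have imp: "A (c + z) \<ge> \<alpha>" if "A (c - z) \<ge> \<alpha>" "0 < \<alpha>" "\<alpha> \<le> 1" for z \<alpha>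
  proof -
    have \<alpha>: "\<alpha> \<in> {0..1}" using that by simp
    obtain l u where lu: "l \<le> u" "level A \<alpha> = {l..u}"
      using fuzzy_number_level[OF A \<alpha>] .
    have sum: "u + l = 2 * c"
      using lower_upper_interval[OF lu] c[OF \<alpha>] by simp
    have iff: "x \<in> {l..u} \<longleftrightarrow> A x \<ge> \<alpha>" for x
      unfolding lu(2)[symmetric] using \<open>0 < \<alpha>\<close> by (simp add: level_def)
    have "c - z \<in> {l..u}" unfolding iff by (rule that(1))
    then have "c + z \<in> {l..u}" using sum by auto
    then show ?thesis unfolding iff .
  qed
  have le: "A (c - z) \<le> A (c + z)" for z
    using imp[of "A (c - z)" z] fuzzy_number_subset[OF A]
    by (cases "A (c - z) = 0") (simp_all add: fuzzy_subset_def order_less_le)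
  show ?thesis using le[of y] le[of "- y"] by simp
qed

lemma affine_fuzzy_inject:
  assumes A: "fuzzy_number A" and as: "asymmetric A"
  shows "affine_fuzzy A r q = affine_fuzzy A r' q' \<longleftrightarrow> r = r' \<and> q = q'"
proof
  assume eq: "affine_fuzzy A r q = affine_fuzzy A r' q'"
  have s: "2 * r + q * (upper A \<alpha> + lower A \<alpha>) = 2 * r' + q' * (upper A \<alpha> + lower A \<alpha>)"
    if "\<alpha> \<in> {0..1}" for \<alpha>
    using sum_lower_upper_affine_fuzzy[OF A that, of r q] sum_lower_upper_affine_fuzzy[OF A that, of r' q'] eq
    by simp
  have no: "\<not> (\<forall>\<alpha>\<in>{0..1}. upper A \<alpha> + lower A \<alpha> = 2 * c)" for c
    using symmetric_if_constant_midpoints[OF A, of c] as unfolding asymmetric_def by metis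
  have "q = q'"
  proof (rule ccontr)
    assume "q \<noteq> q'"
    then have "upper A \<alpha> + lower A \<alpha> = 2 * ((r' - r) / (q - q'))" if "\<alpha> \<in> {0..1}" for \<alpha>
      using s[OF that] by (simp add: field_simps)
    then show False using no by blast
  qed
  then show "r = r' \<and> q = q'" using s[of 0] by simp
qed simp

end

theory Submission
  imports Defs
begin

text \<open>
  The relation is the lexicographic order of the key \<open>(r + q m, \<bar>q\<bar>, q)\<close> in \<open>\<real>\<^sup>3\<close>, where \<open>m\<close>
  is the midpoint of the core of \<open>A\<close>, pulled back to the fuzzy numbers \<open>r + q A\<close>. A pullback of a
  total order is always reflexive, transitive and total; it is antisymmetric as soon as the key
  determines the element. Here it does: \<open>q\<close> is a component of the key, and then \<open>r\<close> is recovered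
  from \<open>r + q m\<close>.

  Asymmetry of the fuzzy number \<open>A\<close> makes the key a function of the fuzzy number alone: by
  \<open>affine_fuzzy_inject\<close> the coefficients \<open>r\<close> and \<open>q\<close> are unique. Hence the
  coefficients quantified existentially in the order relation are those of the given
  representations, and an element keeps the same key in all its comparisons.
\<close>

definition key_le :: "real \<Rightarrow> real \<Rightarrow> real \<Rightarrow> real \<Rightarrow> bool" where
  "key_le a q a' q' \<longleftrightarrow>
     a < a' \<or> (a = a' \<and> \<bar>q\<bar> < \<bar>q'\<bar>) \<or> (a = a' \<and> \<bar>q\<bar> = \<bar>q'\<bar> \<and> q \<le> q')"

lemma key_le_refl: "key_le a q a q"
  by (simp add: key_le_def)

lemma key_le_trans: "key_le a q a' q' \<Longrightarrow> key_le a' q' a'' q'' \<Longrightarrow> key_le a q a'' q''"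
  unfolding key_le_def by (elim disjE conjE) simp_all

lemma key_le_antisym: "key_le a q a' q' \<Longrightarrow> key_le a' q' a q \<Longrightarrow> a = a' \<and> q = q'"
  unfolding key_le_def by (elim disjE conjE) simp_all

lemma key_le_total: "key_le a q a' q' \<or> key_le a' q' a q"
proof -
  have "a < a' \<or> a' < a \<or> a = a' \<and> (\<bar>q\<bar> < \<bar>q'\<bar> \<or> \<bar>q'\<bar> < \<bar>q\<bar> \<or> \<bar>q\<bar> = \<bar>q'\<bar> \<and> (q \<le> q' \<or> q' \<le> q))"
    by (metis linorder_less_linear linear)
  then show ?thesis
    unfolding key_le_def by metis
qed

text \<open>This is where asymmetry enters: uniqueness of the coefficients removes the existential
  quantifiers, so that the order on fuzzy numbers becomes the order on their keys.\<close>

lemma affine_fuzzy_le_iff_key_le: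
  assumes "fuzzy_number A" and "asymmetric A"
  shows "(affine_fuzzy A r q, affine_fuzzy A r' q') \<in> fuzzy_order A
           \<longleftrightarrow> key_le (r + q * midpoint1 A) q (r' + q' * midpoint1 A) q'"
proof -
  have "(affine_fuzzy A r q, affine_fuzzy A r' q') \<in> fuzzy_order A \<longleftrightarrow>
      (\<exists>s p s' p'. (r = s \<and> q = p) \<and> (r' = s' \<and> q' = p') \<and>
         key_le (s + p * midpoint1 A) p (s' + p' * midpoint1 A) p')"
    unfolding fuzzy_order_def key_le_def Let_def mem_Collect_eq prod.case
      affine_fuzzy_inject[OF assms] by (rule refl)
  then show ?thesis by fast
qed

lemma fuzzy_order_subset: "fuzzy_order A \<subseteq> fuzzy_span A \<times> fuzzy_span A"
  unfolding fuzzy_order_def fuzzy_span_def by blast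

theorem proposition3:
  fixes A :: "real \<Rightarrow> real"
  assumes "fuzzy_number A" and "asymmetric A"
  shows "linear_order_on (fuzzy_span A) (fuzzy_order A)"
proof -
  note iff = affine_fuzzy_le_iff_key_le[OF assms]
  have span: "\<exists>r q. B = affine_fuzzy A r q" if "B \<in> fuzzy_span A" for B
    using that unfolding fuzzy_span_def by blast
  have pair: "B \<in> fuzzy_span A \<and> C \<in> fuzzy_span A" if "(B, C) \<in> fuzzy_order A" for B C
    using that fuzzy_order_subset by blast
  have "refl_on (fuzzy_span A) (fuzzy_order A)"
  proof (rule refl_onI)
    fix B assume "B \<in> fuzzy_span A"
    then obtain r q where B: "B = affine_fuzzy A r q"
      using span by blast
    show "(B, B) \<in> fuzzy_order A"
      unfolding B iff by (rule key_le_refl)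
  qed
  moreover have "trans (fuzzy_order A)"
  proof (rule transI)
    fix B C D assume BC: "(B, C) \<in> fuzzy_order A" and CD: "(C, D) \<in> fuzzy_order A"
    obtain r q r' q' r'' q'' where
      B: "B = affine_fuzzy A r q" and C: "C = affine_fuzzy A r' q'" and D: "D = affine_fuzzy A r'' q''"
      using span pair[OF BC] pair[OF CD] by metis
    from BC CD show "(B, D) \<in> fuzzy_order A"
      unfolding B C D iff by (rule key_le_trans)
  qed
  moreover have "antisym (fuzzy_order A)"
  proof (rule antisymI)
    fix B C assume BC: "(B, C) \<in> fuzzy_order A" and CB: "(C, B) \<in> fuzzy_order A"
    obtain r q r' q' where B: "B = affine_fuzzy A r q" and C: "C = affine_fuzzy A r' q'"
      using span pair[OF BC] by metis
    from BC CB have "r + q * midpoint1 A = r' + q' * midpoint1 A \<and> q = q'"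
      unfolding B C iff by (rule key_le_antisym)
    then have "q = q'" and "r = r'" by auto
    then show "B = C"
      unfolding B C by simp
  qed
  moreover have "total_on (fuzzy_span A) (fuzzy_order A)"
  proof (rule total_onI)
    fix B C assume "B \<in> fuzzy_span A" "C \<in> fuzzy_span A"
    then obtain r q r' q' where B: "B = affine_fuzzy A r q" and C: "C = affine_fuzzy A r' q'"
      using span by metis
    show "(B, C) \<in> fuzzy_order A \<or> (C, B) \<in> fuzzy_order A"
      unfolding B C iff by (rule key_le_total)
  qed
  ultimately show ?thesis
    using fuzzy_order_subset
    by (simp add: linear_order_on_def partial_order_on_def preorder_on_def)
qed

end
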